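(* Let $G=(V,E)$ be a finite undirected graph with positive edge weights. Every real $\lambda$ that is an eigenvalue of $\Delta_1$ with a nonconstant eigenvector is also an eigenvalue of problem (P) with a nonconstant eigenvector. Moreover, the smallest eigenvalue of $\Delta_1$ admitting a nonconstant eigenvector and the smallest eigenvalue of (P) admitting a nonconstant eigenvector both equal the Cheeger constant $h(G)=\min_{\emptyset\neq S\subsetneq V}\frac{|E(S,V\setminus S)|}{\min\{\mathrm{vol}(S),\mathrm{vol}(V\setminus S)\}}$.
   Context: $V=\{1,\dots,n\}$, edge weights $w_{ij}=w_{ji}>0$; $d_i=\sum_{j:\{i,j\}\in E}w_{ij}$; $\mathrm{vol}(S)=\sum_{i\in S}d_i$; $|E(A,B)|=\sum_{i\in A,j\in B,\{i,j\}\in E}w_{ij}$. $\mathrm{Sgn}(t)=\{1\},[-1,1],\{-1\}$ for $t>0,t=0,t<0$. Graph 1-Laplacian: $(\Delta_1\vec x)_i=\{\sum_{j:\{i,j\}\in E}w_{ij}z_{ij}: z_{ij}\in\mathrm{Sgn}(x_i-x_j), z_{ij}=-z_{ji}\}$; $(\lambda,\vec x)$ is an eigenpair of $\Delta_1$ if $\vec x\neq\vec0$ and $\Delta_1\vec x\cap\lambda\,\mathrm{diag}(d_1,\dots,d_n)\mathrm{Sgn}(\vec x)\ne\emptyset$. $I^+(\vec x)=\sum_{\{i,j\}\in E}w_{ij}|x_i+x_j|$, $\Delta_1^+\vec x=\partial I^+(\vec x)$, $N(\vec x)=\min_t\sum_i d_i|x_i-t|$. Problem (P): $(\lambda,\vec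 x)$ with $\vec x\ne\vec 0$ and $\vec 0\in \mathrm{vol}(V)\,\partial\|\vec x\|_\infty-\Delta_1^+\vec x-\lambda\,\partial N(\vec x)$.
   Formalization: The claim about the smallest eigenvalues and h(G) is stated for graphs without isolated vertices; with an isolated vertex h(G) involves 0/0 or an empty minimum, and on two or more vertices every real number is then an eigenvalue of Δ_1 with a nonconstant eigenvector. *)

theory Defs
  imports "HOL-Analysis.Analysis"
begin

text \<open>
  The vertex set is the finite type \<open>'n\<close>. An edge is a two-element vertex set and the weights
  are a function on edges, so \<open>w {i, j}\<close> is $w_{ij} = w_{ji}$. The values of \<open>w\<close> outside \<open>E\<close> are
  irrelevant.
\<close>

definition weighted_graph :: "'n set set \<Rightarrow> ('n set \<Rightarrow> real) \<Rightarrow> bool" where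
  "weighted_graph E w \<longleftrightarrow> (\<forall>e\<in>E. card e = 2 \<and> 0 < w e)"

definition deg :: "'n::finite set set \<Rightarrow> ('n set \<Rightarrow> real) \<Rightarrow> 'n \<Rightarrow> real" where
  "deg E w i = (\<Sum>j | {i, j} \<in> E. w {i, j})"

definition vol :: "'n::finite set set \<Rightarrow> ('n set \<Rightarrow> real) \<Rightarrow> 'n set \<Rightarrow> real" where
  "vol E w S = (\<Sum>i\<in>S. deg E w i)"

definition cut :: "'n::finite set set \<Rightarrow> ('n set \<Rightarrow> real) \<Rightarrow> 'n set \<Rightarrow> 'n set \<Rightarrow> real" where
  "cut E w A B = (\<Sum>i\<in>A. \<Sum>j | j \<in> B \<and> {i, j} \<in> E. w {i, j})"

text \<open>
  The quotients are genuine only if no vertex is isolated; otherwise the denominator vanishes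
  for some \<open>S\<close>. The minimum is over a nonempty family only if there are at least two vertices.
\<close>

definition cheeger :: "'n::finite set set \<Rightarrow> ('n set \<Rightarrow> real) \<Rightarrow> real" where
  "cheeger E w =
     Min {cut E w S (- S) / min (vol E w S) (vol E w (- S)) | S. S \<noteq> {} \<and> S \<noteq> UNIV}"

definition Sgn :: "real \<Rightarrow> real set" where
  "Sgn t = (if t > 0 then {1} else if t = 0 then {-1..1} else {-1})"

definition nonconstant :: "real ^ 'n \<Rightarrow> bool" where
  "nonconstant x \<longleftrightarrow> (\<exists>i j. x $ i \<noteq> x $ j)"

definition subdifferential :: "('a::real_inner \<Rightarrow> real) \<Rightarrow> 'a \<Rightarrow> 'a set" where
  "subdifferential f x = {u. \<forall>y. f x + u \<bullet> (y - x) \<le> f y}"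

text \<open>One antisymmetric family \<open>z\<close> serves all the coordinates simultaneously.\<close>

definition Delta1 :: "'n::finite set set \<Rightarrow> ('n set \<Rightarrow> real) \<Rightarrow> real ^ 'n \<Rightarrow> (real ^ 'n) set" where
  "Delta1 E w x =
     {(\<chi> i. \<Sum>j | {i, j} \<in> E. w {i, j} * z i j) | z :: 'n \<Rightarrow> 'n \<Rightarrow> real.
        \<forall>i j. {i, j} \<in> E \<longrightarrow> z i j \<in> Sgn (x $ i - x $ j) \<and> z i j = - z j i}"

definition eigenpair_Delta1 ::
    "'n::finite set set \<Rightarrow> ('n set \<Rightarrow> real) \<Rightarrow> real \<Rightarrow> real ^ 'n \<Rightarrow> bool" where
  "eigenpair_Delta1 E w \<mu> x \<longleftrightarrow>
     x \<noteq> 0 \<and>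
     Delta1 E w x \<inter> {(\<chi> i. \<mu> * (deg E w i * s $ i)) | s. \<forall>i. s $ i \<in> Sgn (x $ i)} \<noteq> {}"

text \<open>Since \<open>e = {i, j}\<close> has two elements, the inner sum is $x_i + x_j$.\<close>

definition Iplus :: "'n::finite set set \<Rightarrow> ('n set \<Rightarrow> real) \<Rightarrow> real ^ 'n \<Rightarrow> real" where
  "Iplus E w x = (\<Sum>e\<in>E. w e * \<bar>\<Sum>i\<in>e. x $ i\<bar>)"

definition Delta1_plus ::
    "'n::finite set set \<Rightarrow> ('n set \<Rightarrow> real) \<Rightarrow> real ^ 'n \<Rightarrow> (real ^ 'n) set" where
  "Delta1_plus E w x = subdifferential (Iplus E w) x"

text \<open>The infimum is attained, at a weighted median of the coordinates of \<open>x\<close>.\<close>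

definition Nfun :: "'n::finite set set \<Rightarrow> ('n set \<Rightarrow> real) \<Rightarrow> real ^ 'n \<Rightarrow> real" where
  "Nfun E w x = (INF t. \<Sum>i\<in>UNIV. deg E w i * \<bar>x $ i - t\<bar>)"

definition eigenpair_P ::
    "'n::finite set set \<Rightarrow> ('n set \<Rightarrow> real) \<Rightarrow> real \<Rightarrow> real ^ 'n \<Rightarrow> bool" where
  "eigenpair_P E w \<mu> x \<longleftrightarrow>
     x \<noteq> 0 \<and>
     0 \<in> {vol E w UNIV *\<^sub>R p - q - \<mu> *\<^sub>R r | p q r.
            p \<in> subdifferential infnorm x \<and> q \<in> Delta1_plus E w x \<and>
            r \<in> subdifferential (Nfun E w) x}"

definition nonconst_eigenvalues_Delta1 ::
    "'n::finite set set \<Rightarrow> ('n set \<Rightarrow> real) \<Rightarrow> real set" where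
  "nonconst_eigenvalues_Delta1 E w = {\<mu>. \<exists>x. nonconstant x \<and> eigenpair_Delta1 E w \<mu> x}"

definition nonconst_eigenvalues_P ::
    "'n::finite set set \<Rightarrow> ('n set \<Rightarrow> real) \<Rightarrow> real set" where
  "nonconst_eigenvalues_P E w = {\<mu>. \<exists>x. nonconstant x \<and> eigenpair_P E w \<mu> x}"

definition is_smallest :: "real \<Rightarrow> real set \<Rightarrow> bool" where
  "is_smallest m A \<longleftrightarrow> m \<in> A \<and> (\<forall>a\<in>A. m \<le> a)"

end

theory Submission
  imports Defs
begin

text \<open>
  An eigenvector of $\Delta_1$ may be replaced by the indicator of one of its level sets \<open>A\<close>
  with the same \<open>z\<close> and \<open>\<mu>\<close>, and then the vector equal to \<open>1\<close> on \<open>A\<close> and to \<open>-1\<close> off \<open>A\<close> solves (P)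
  for the same \<open>\<mu>\<close>; an isolated vertex makes every \<open>\<mu>\<close> an eigenvalue on both sides.

  Pairing (P) with \<open>x\<close> gives $\mathrm{vol}(V)\|x\|_\infty - I^+(x) = \mu N(x)$. Since
  $|a - b| + |a + b| = 2\max(|a|, |b|)$, the left side is at least the total variation of \<open>x\<close>,
  which is at least $h\,N(x)$ by the coarea formula around a median, so $\mu \ge h$.

  For a Cheeger cut \<open>A\<close> the same inequality makes $h$ times a balanced extension of $d|_A$ a
  subgradient of the total variation at the indicator of \<open>A\<close>, so \<open>h\<close> is an eigenvalue of $\Delta_1$.
\<close>

section \<open>Symmetric weights and sums over pairs of vertices\<close>

text \<open>Extending the weights by zero to all pairs of vertices lets every sum run over a full
  product, so that summation order can be swapped freely.\<close>

definition wt :: "'n set set \<Rightarrow> ('n set \<Rightarrow> real) \<Rightarrow> 'n \<Rightarrow> 'n \<Rightarrow> real" where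
  "wt E w i j = (if {i, j} \<in> E then w {i, j} else 0)"

text \<open>The sum runs over ordered pairs, so each edge counts twice; the factors 2 in front of
  cuts and deviations below compensate for this.\<close>

definition total_variation :: "'n::finite set set \<Rightarrow> ('n set \<Rightarrow> real) \<Rightarrow> ('n \<Rightarrow> real) \<Rightarrow> real" where
  "total_variation E w f = (\<Sum>i\<in>UNIV. \<Sum>j\<in>UNIV. wt E w i j * \<bar>f i - f j\<bar>)"

lemma wt_commute: "wt E w i j = wt E w j i"
  by (simp add: wt_def insert_commute)

lemma wt_nonneg: "weighted_graph E w \<Longrightarrow> 0 \<le> wt E w i j"
  by (auto simp: wt_def weighted_graph_def less_imp_le)

lemma sum_neighbours:
  fixes E :: "'n::finite set set"
  shows "(\<Sum>j | {i, j} \<in> E. w {i, j} * f j) = (\<Sum>j\<in>UNIV. wt E w i j * f j)"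
proof -
  have "(\<Sum>j | {i, j} \<in> E. w {i, j} * f j)
      = (\<Sum>j\<in>UNIV. if {i, j} \<in> E then w {i, j} * f j else 0)"
    using sum.inter_filter[of UNIV "\<lambda>j. w {i, j} * f j" "\<lambda>j. {i, j} \<in> E"] by simp
  also have "\<dots> = (\<Sum>j\<in>UNIV. wt E w i j * f j)"
    by (rule sum.cong) (auto simp: wt_def)
  finally show ?thesis .
qed

lemma deg_eq_sum_wt: "deg E w i = (\<Sum>j\<in>UNIV. wt E w i j)"
  using sum_neighbours[where f = "\<lambda>_. 1"] by (simp add: deg_def)

lemma cut_eq_sum_wt: "cut E w A B = (\<Sum>i\<in>A. \<Sum>j\<in>B. wt E w i j)"
  unfolding cut_def wt_def by (simp add: sum.inter_filter[symmetric] conj_commute)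

lemma cut_commute: "cut E w A B = cut E w B A"
  unfolding cut_eq_sum_wt by (subst sum.swap) (simp add: wt_commute)

lemma vol_UNIV_eq: "vol E w UNIV = vol E w S + vol E w (- S)"
  unfolding vol_def using sum.subset_diff[of S UNIV "deg E w"]
  by (simp add: Compl_eq_Diff_UNIV)

lemma deg_nonneg: "weighted_graph E w \<Longrightarrow> 0 \<le> deg E w i"
  by (simp add: deg_eq_sum_wt sum_nonneg wt_nonneg)

lemma deg_pos:
  assumes "weighted_graph E w" "{i, j} \<in> E"
  shows "0 < deg E w i"
  unfolding deg_eq_sum_wt using assms
  by (intro sum_pos2[of _ j]) (auto simp: wt_nonneg, auto simp: wt_def weighted_graph_def)

text \<open>Swapping the two summations turns the sum into its own negative. Applied to a flow on
  the edges, this says that its total divergence is zero.\<close>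

lemma sum_skew_eq_0:
  fixes g :: "'a \<Rightarrow> 'a \<Rightarrow> real"
  assumes "\<And>i j. i \<in> S \<Longrightarrow> j \<in> S \<Longrightarrow> g i j = - g j i"
  shows "(\<Sum>i\<in>S. \<Sum>j\<in>S. g i j) = 0"
proof -
  have "(\<Sum>i\<in>S. \<Sum>j\<in>S. g i j) = (\<Sum>i\<in>S. \<Sum>j\<in>S. - g j i)"
    by (intro sum.cong refl) (rule assms)
  also have "\<dots> = - (\<Sum>i\<in>S. \<Sum>j\<in>S. g i j)"
    by (subst sum.swap) (simp add: sum_negf)
  finally show ?thesis by simp
qed

text \<open>For fixed \<open>i\<close>, the map from \<open>j\<close> to \<open>{i, j}\<close> is a
  bijection from the neighbours of \<open>i\<close> onto the edges at \<open>i\<close>; each edge is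
  then counted once for each of its two endpoints.\<close>

lemma sum_edges:
  fixes E :: "'n::finite set set"
  assumes "weighted_graph E w"
  shows "(\<Sum>i\<in>UNIV. \<Sum>j\<in>UNIV. wt E w i j * g {i, j}) = 2 * (\<Sum>e\<in>E. w e * g e)"
proof -
  have card2: "card e = 2" if "e \<in> E" for e
    using assms that by (simp add: weighted_graph_def)
  have "(\<Sum>j\<in>UNIV. wt E w i j * g {i, j}) = (\<Sum>e\<in>E. if i \<in> e then w e * g e else 0)" for i
  proof -
    have "inj_on (\<lambda>j. {i, j}) {j. {i, j} \<in> E}"
      by (auto simp: inj_on_def doubleton_eq_iff)
    moreover have "(\<lambda>j. {i, j}) ` {j. {i, j} \<in> E} = {e \<in> E. i \<in> e}"
      using card2 by (auto simp: card_2_iff' image_iff) (metis card2 card_2_iff insert_absorb insert_commute insert_iff)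
    ultimately have "(\<Sum>e | e \<in> E \<and> i \<in> e. w e * g e) = (\<Sum>j | {i, j} \<in> E. w {i, j} * g {i, j})"
      by (metis (mono_tags, lifting) sum.reindex_cong)
    then show ?thesis
      by (simp add: sum_neighbours[where f = "\<lambda>j. g {i, j}"] sum.inter_filter)
  qed
  then have "(\<Sum>i\<in>UNIV. \<Sum>j\<in>UNIV. wt E w i j * g {i, j})
      = (\<Sum>e\<in>E. \<Sum>i\<in>UNIV. if i \<in> e then w e * g e else 0)"
    by (simp add: sum.swap[of _ E])
  also have "\<dots> = (\<Sum>e\<in>E. 2 * (w e * g e))"
    by (rule sum.cong) (simp_all add: card2 flip: sum.inter_filter)
  finally show ?thesis by (simp add: sum_distrib_left)
qed

lemma Iplus_eq_sum_wt:
  assumes "weighted_graph E w"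
  shows "2 * Iplus E w x = (\<Sum>i\<in>UNIV. \<Sum>j\<in>UNIV. wt E w i j * \<bar>x $ i + x $ j\<bar>)"
proof -
  \<comment> \<open>For \<open>i = j\<close> the sum over \<open>{i, j}\<close> has only one term
    and the absolute values differ, but a singleton is not an edge and the weight is zero.\<close>
  have "wt E w i j * \<bar>\<Sum>k\<in>{i, j}. x $ k\<bar> = wt E w i j * \<bar>x $ i + x $ j\<bar>" for i j
    using assms by (cases "i = j") (auto simp: wt_def weighted_graph_def)
  then show ?thesis
    using sum_edges[OF assms, of "\<lambda>e. \<bar>\<Sum>k\<in>e. x $ k\<bar>"] by (simp only: Iplus_def)
qed

section \<open>Subgradients of homogeneous functions and balanced sign vectors\<close>

text \<open>A linear functional that stays below \<open>f\<close> and touches it at \<open>x\<close>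
  is a subgradient there. All three subgradients needed for (P) are produced in this way.\<close>

lemma subdifferential_of_support:
  assumes "f x \<le> u \<bullet> x" "\<And>y. u \<bullet> y \<le> f y"
  shows "u \<in> subdifferential f x"
  unfolding subdifferential_def
proof safe
  fix y
  show "f x + u \<bullet> (y - x) \<le> f y"
    using assms(1) assms(2)[of y] by (simp add: inner_diff_right)
qed

text \<open>This is Euler's identity: the subgradient inequality tested at \<open>0\<close> bounds
  \<open>u \<bullet> x\<close> from below, and tested at twice \<open>x\<close> it gives the
  matching upper bound.\<close>

lemma subdifferential_homogeneous:
  assumes "u \<in> subdifferential f x" "f 0 = 0" "f (2 *\<^sub>R x) = 2 * f x"
  shows "u \<bullet> x = f x"
proof -
  have "f x + u \<bullet> (0 - x) \<le> f 0" "f x + u \<bullet> (2 *\<^sub>R x - x) \<le> f (2 *\<^sub>R x)"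
    using assms(1) unfolding subdifferential_def by blast+
  then show ?thesis
    using assms(2,3) by (simp add: inner_diff_right)
qed

lemma Nfun_le:
  assumes "weighted_graph E w"
  shows "Nfun E w x \<le> (\<Sum>i\<in>UNIV. deg E w i * \<bar>x $ i - t\<bar>)"
  unfolding Nfun_def
  by (rule cINF_lower) (auto intro!: bdd_belowI2[where m=0] sum_nonneg simp: deg_nonneg[OF assms])

text \<open>Balance makes the pairing invariant under subtracting a constant \<open>t\<close> from
  \<open>y\<close>. As \<open>t\<close> is arbitrary, the functional lies below \<open>Nfun\<close>,
  which is what a subgradient of it requires.\<close>

lemma balanced_inner_le:
  assumes "weighted_graph E w" "\<And>i. \<bar>s i\<bar> \<le> 1" "(\<Sum>i\<in>UNIV. deg E w i * s i) = 0"
  shows "(\<Sum>i\<in>UNIV. deg E w i * s i * y i) \<le> (\<Sum>i\<in>UNIV. deg E w i * \<bar>y i - t\<bar>)"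
proof -
  have "(\<Sum>i\<in>UNIV. deg E w i * s i * y i) = (\<Sum>i\<in>UNIV. deg E w i * s i * (y i - t))"
    using assms(3) by (simp add: right_diff_distrib sum_subtractf flip: sum_distrib_right)
  also have "\<dots> \<le> (\<Sum>i\<in>UNIV. deg E w i * \<bar>y i - t\<bar>)"
  proof (rule sum_mono)
    fix i
    have "s i * (y i - t) \<le> \<bar>s i\<bar> * \<bar>y i - t\<bar>"
      by (metis abs_ge_self abs_mult)
    also have "\<dots> \<le> 1 * \<bar>y i - t\<bar>"
      by (rule mult_right_mono) (use assms(2) in auto)
    finally show "deg E w i * s i * (y i - t) \<le> deg E w i * \<bar>y i - t\<bar>"
      using deg_nonneg[OF assms(1), of i] by (simp add: mult.assoc mult_left_mono)
  qed
  finally show ?thesis .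
qed

lemma balanced_sign_exists:
  assumes "weighted_graph E w" "vol E w A \<le> vol E w (- A)"
  obtains s where "\<And>i. i \<in> A \<Longrightarrow> s i = 1" "\<And>i. \<bar>s i\<bar> \<le> 1" "(\<Sum>i\<in>UNIV. deg E w i * s i) = 0"
proof
  \<comment> \<open>The constant is forced by balance. If the complement has volume zero, then so
    does \<open>A\<close>, and division by zero yields \<open>c = 0\<close>, which is still
    balanced.\<close>
  define c where "c = vol E w A / vol E w (- A)"
  define s where "s i = (if i \<in> A then 1 else - c)" for i
  have vA: "0 \<le> vol E w A"
    unfolding vol_def by (rule sum_nonneg) (simp add: deg_nonneg assms(1))
  have "0 \<le> c" "c \<le> 1"
    using vA assms(2) by (auto simp: c_def divide_le_eq_1)
  then show "\<bar>s i\<bar> \<le> 1" for i by (simp add: s_def)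
  show "s i = 1" if "i \<in> A" for i using that by (simp add: s_def)
  have "vol E w A = vol E w (- A) * c"
    using vA assms(2) by (simp add: c_def)
  moreover have "(\<Sum>i\<in>UNIV. deg E w i * s i) = (\<Sum>i\<in>A. deg E w i * s i) + (\<Sum>i\<in>-A. deg E w i * s i)"
    using sum.subset_diff[of A UNIV "\<lambda>i. deg E w i * s i"] by (simp add: Compl_eq_Diff_UNIV)
  moreover have "(\<Sum>i\<in>A. deg E w i * s i) = vol E w A"
    by (simp add: s_def vol_def)
  moreover have "(\<Sum>i\<in>-A. deg E w i * s i) = - (vol E w (- A) * c)"
    by (simp add: s_def vol_def sum_distrib_right flip: sum_negf)
  ultimately show "(\<Sum>i\<in>UNIV. deg E w i * s i) = 0" by simp
qed

section \<open>Solutions of (P) from cuts\<close>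

text \<open>
  The contributions of \<open>z\<close> inside \<open>A\<close> and inside its complement cancel by antisymmetry, so
  \<open>q + \<mu> r\<close> has the signs of \<open>y\<close> and \<open>l\<^sub>1\<close>-norm exactly \<open>vol(V)\<close>.
\<close>

lemma eigenvalue_P_of_cut:
  fixes E :: "'n::finite set set"
  assumes G: "weighted_graph E w"
    and A: "A \<noteq> {}" "A \<noteq> UNIV"
    and z1: "\<And>i j. {i, j} \<in> E \<Longrightarrow> \<bar>z i j\<bar> \<le> 1"
    and zanti: "\<And>i j. {i, j} \<in> E \<Longrightarrow> z i j = - z j i"
    and zcut: "\<And>i j. {i, j} \<in> E \<Longrightarrow> i \<in> A \<Longrightarrow> j \<notin> A \<Longrightarrow> z i j = 1"
    and s1: "\<And>i. \<bar>s i\<bar> \<le> 1"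
    and sA: "\<And>i. i \<in> A \<Longrightarrow> s i = 1"
    and s0: "(\<Sum>i\<in>UNIV. deg E w i * s i) = 0"
    and flow: "\<And>i. (\<Sum>j\<in>UNIV. wt E w i j * z i j) = \<mu> * (deg E w i * s i)"
  shows "\<mu> \<in> nonconst_eigenvalues_P E w"
proof -
  define \<sigma> where "\<sigma> i = (if i \<in> A then 1 else - 1 :: real)" for i
  define y where "y = (\<chi> i. \<sigma> i)"
  \<comment> \<open>The edge value \<open>(\<sigma> i + \<sigma> j) / 2\<close> is a sign of the sum
    of the two coordinates of \<open>y\<close>: it is \<open>\<sigma> i\<close> within a side and
    \<open>0\<close> across the cut.\<close>
  define q where "q = (\<chi> i. \<Sum>j\<in>UNIV. wt E w i j * ((\<sigma> i + \<sigma> j) / 2))"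
  define r where "r = (\<chi> i. deg E w i * s i)"
  \<comment> \<open>Up to the factor \<open>\<sigma> i\<close> this is coordinate \<open>i\<close>
    of \<open>q + \<mu> r\<close>, with \<open>\<mu> r\<close> expressed through the flow. It
    becomes the mass that \<open>p\<close>, scaled by the volume, must place on vertex
    \<open>i\<close>.\<close>
  define \<theta> where "\<theta> i = (\<Sum>j\<in>UNIV. wt E w i j * (\<sigma> i * ((\<sigma> i + \<sigma> j) / 2 + z i j)))" for i
  have \<sigma>sq: "\<sigma> i * \<sigma> i = 1" "\<bar>\<sigma> i\<bar> = 1" for i by (simp_all add: \<sigma>_def)
  obtain a b where ab: "a \<in> A" "b \<notin> A" using A by auto
  have \<theta>_nonneg: "0 \<le> \<theta> i" for i
    unfolding \<theta>_def
  proof (rule sum_nonneg)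
    fix j
    show "0 \<le> wt E w i j * (\<sigma> i * ((\<sigma> i + \<sigma> j) / 2 + z i j))"
    proof (cases "{i, j} \<in> E")
      case True
      then have "{j, i} \<in> E" by (simp add: insert_commute)
      \<comment> \<open>Within a side the value is \<open>1 + \<sigma> i * z i j\<close>; across the
        cut it is \<open>1\<close>, because \<open>z\<close> has value \<open>1\<close> when leaving
        \<open>A\<close>.\<close>
      then have "0 \<le> \<sigma> i * ((\<sigma> i + \<sigma> j) / 2 + z i j)"
        using z1[OF True] zcut[OF True] zcut[of j i] zanti[OF True]
        by (auto simp: \<sigma>_def split: if_splits)
      then show ?thesis by (simp add: wt_nonneg[OF G])
    qed (simp add: wt_def)
  qed
  have \<theta>_eq: "\<sigma> i * \<theta> i = q $ i + \<mu> * r $ i" for i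
  proof -
    have "\<sigma> i * \<theta> i = (\<Sum>j\<in>UNIV. wt E w i j * ((\<sigma> i * \<sigma> i) * ((\<sigma> i + \<sigma> j) / 2 + z i j)))"
      unfolding \<theta>_def by (simp add: sum_distrib_left algebra_simps)
    also have "\<dots> = q $ i + \<mu> * r $ i"
      unfolding \<sigma>sq by (simp add: q_def r_def flow[symmetric] distrib_left sum.distrib)
    finally show ?thesis .
  qed
  have \<theta>_sum: "(\<Sum>i\<in>UNIV. \<theta> i) = vol E w UNIV"
  proof -
    have "(\<Sum>i\<in>UNIV. \<theta> i) - vol E w UNIV
        = (\<Sum>i\<in>UNIV. \<Sum>j\<in>UNIV. wt E w i j * (\<sigma> i * ((\<sigma> i + \<sigma> j) / 2 + z i j) - 1))"
      by (simp add: \<theta>_def vol_def deg_eq_sum_wt right_diff_distrib sum_subtractf)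
    \<comment> \<open>After subtracting \<open>1\<close>, what remains is
      \<open>\<sigma> i * z i j\<close> within a side, which is antisymmetric, and \<open>0\<close>
      across the cut.\<close>
    also have "\<dots> = 0"
    proof (rule sum_skew_eq_0)
      fix i j
      show "wt E w i j * (\<sigma> i * ((\<sigma> i + \<sigma> j) / 2 + z i j) - 1)
          = - (wt E w j i * (\<sigma> j * ((\<sigma> j + \<sigma> i) / 2 + z j i) - 1))"
      proof (cases "{i, j} \<in> E")
        case True
        then have "{j, i} \<in> E" by (simp add: insert_commute)
        then show ?thesis
          using zcut[OF True] zcut[of j i] zanti[OF True] wt_commute[of E w i j]
          by (auto simp: \<sigma>_def algebra_simps)
      qed (simp add: wt_def insert_commute)
    qed
    finally show ?thesis by simp
  qed
  \<comment> \<open>Normalising \<open>\<theta>\<close> gives a probability vector. If the total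
    volume is zero, then \<open>\<theta>\<close> vanishes and any probability vector serves; the
    point mass at \<open>a\<close> is chosen.\<close>
  obtain \<pi> where \<pi>: "\<And>i. 0 \<le> \<pi> i" "sum \<pi> UNIV = (1::real)" "\<And>i. vol E w UNIV * \<pi> i = \<theta> i"
  proof (cases "vol E w UNIV = 0")
    case True
    have "\<theta> i = 0" for i
      using \<theta>_sum \<theta>_nonneg True by (simp add: sum_nonneg_eq_0_iff)
    then show ?thesis
      using that[of "\<lambda>i. if i = a then 1 else 0"] True by simp
  next
    case False
    moreover have "0 \<le> vol E w UNIV"
      by (simp add: \<theta>_nonneg sum_nonneg flip: \<theta>_sum)
    ultimately show ?thesis
      using that[of "\<lambda>i. \<theta> i / vol E w UNIV"] \<theta>_nonneg \<theta>_sum by (simp flip: sum_divide_distrib)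
  qed
  \<comment> \<open>Every coordinate of \<open>y\<close> has absolute value \<open>1\<close>, so any
    convex combination of the signed coordinate functionals is a subgradient of the norm at
    \<open>y\<close>.\<close>
  define p where "p = (\<chi> i. \<pi> i * \<sigma> i)"
  have p_inner: "p \<bullet> v = (\<Sum>i\<in>UNIV. \<pi> i * (\<sigma> i * v $ i))" for v
    by (simp add: p_def inner_vec_def mult.assoc)
  have p: "p \<in> subdifferential infnorm y"
  proof (rule subdifferential_of_support)
    have "infnorm y \<le> 1"
      unfolding infnorm_cart by (rule cSup_least) (auto simp: y_def \<sigma>sq)
    then show "infnorm y \<le> p \<bullet> y"
      unfolding p_inner by (simp add: y_def \<sigma>sq \<pi>)
    fix v :: "real^'n"
    have "\<sigma> i * v $ i \<le> infnorm v" for i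
      using component_le_infnorm_cart[of v i] by (auto simp: \<sigma>_def)
    then have "p \<bullet> v \<le> (\<Sum>i\<in>UNIV. \<pi> i * infnorm v)"
      unfolding p_inner by (intro sum_mono mult_left_mono \<pi>)
    then show "p \<bullet> v \<le> infnorm v"
      by (simp add: \<pi> flip: sum_distrib_right)
  qed
  have q_inner: "2 * (q \<bullet> v) = (\<Sum>i\<in>UNIV. \<Sum>j\<in>UNIV. wt E w i j * ((\<sigma> i + \<sigma> j) / 2 * (v $ i + v $ j)))" for v
  proof -
    have 1: "q \<bullet> v = (\<Sum>i\<in>UNIV. \<Sum>j\<in>UNIV. wt E w i j * ((\<sigma> i + \<sigma> j) / 2 * v $ i))"
      by (simp add: q_def inner_vec_def sum_distrib_right mult.assoc)
    also have "\<dots> = (\<Sum>i\<in>UNIV. \<Sum>j\<in>UNIV. wt E w i j * ((\<sigma> i + \<sigma> j) / 2 * v $ j))"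
      by (subst sum.swap) (simp add: wt_commute add.commute)
    finally have 2: "q \<bullet> v = \<dots>" .
    show ?thesis
      unfolding mult_2 by (subst 1, subst 2) (simp add: sum.distrib[symmetric] distrib_left)
  qed
  have q: "q \<in> Delta1_plus E w y"
    unfolding Delta1_plus_def
  proof (rule subdifferential_of_support)
    have "\<bar>\<sigma> i + \<sigma> j\<bar> = (\<sigma> i + \<sigma> j) / 2 * (\<sigma> i + \<sigma> j)" for i j
      by (simp add: \<sigma>_def)
    then have "2 * Iplus E w y = 2 * (q \<bullet> y)"
      unfolding Iplus_eq_sum_wt[OF G] q_inner by (simp only: y_def vec_lambda_beta)
    then show "Iplus E w y \<le> q \<bullet> y" by simp
    fix v :: "real^'n"
    have "(\<sigma> i + \<sigma> j) / 2 * (v $ i + v $ j) \<le> \<bar>v $ i + v $ j\<bar>" for i j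
      using abs_ge_self[of "v $ i + v $ j"] abs_ge_minus_self[of "v $ i + v $ j"]
      by (auto simp: \<sigma>_def)
    then have "2 * (q \<bullet> v) \<le> 2 * Iplus E w v"
      unfolding Iplus_eq_sum_wt[OF G] q_inner by (intro sum_mono mult_left_mono wt_nonneg[OF G])
    then show "q \<bullet> v \<le> Iplus E w v" by simp
  qed
  have r: "r \<in> subdifferential (Nfun E w) y"
  proof (rule subdifferential_of_support)
    \<comment> \<open>The shift \<open>t = -1\<close> makes \<open>y - t\<close> vanish off
      \<open>A\<close>, where \<open>s\<close> is not determined, while on \<open>A\<close> the sign
      is \<open>1\<close>.\<close>
    have "Nfun E w y \<le> (\<Sum>i\<in>UNIV. deg E w i * \<bar>y $ i - (-1)\<bar>)"
      by (rule Nfun_le[OF G])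
    also have "\<dots> = (\<Sum>i\<in>UNIV. deg E w i * s i * (y $ i + 1))"
      by (rule sum.cong) (auto simp: y_def \<sigma>_def sA)
    also have "\<dots> = r \<bullet> y"
      by (simp add: r_def inner_vec_def distrib_left sum.distrib s0)
    finally show "Nfun E w y \<le> r \<bullet> y" .
    fix v :: "real^'n"
    have "r \<bullet> v = (\<Sum>i\<in>UNIV. deg E w i * s i * v $ i)"
      by (simp add: r_def inner_vec_def)
    then show "r \<bullet> v \<le> Nfun E w v"
      unfolding Nfun_def by (intro cINF_greatest) (simp_all add: balanced_inner_le[OF G s1 s0])
  qed
  have "vol E w UNIV *\<^sub>R p - q - \<mu> *\<^sub>R r = 0"
    using \<theta>_eq \<pi>(3) by (simp add: vec_eq_iff p_def flip: mult.assoc) (simp add: mult.commute)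
  moreover have "nonconstant y"
    unfolding nonconstant_def using ab by (intro exI[of _ a] exI[of _ b]) (simp add: y_def \<sigma>_def)
  moreover have "y \<noteq> 0"
    using ab by (auto simp: vec_eq_iff y_def \<sigma>_def)
  ultimately show ?thesis
    unfolding nonconst_eigenvalues_P_def eigenpair_P_def using p q r by fastforce
qed

section \<open>Passage from eigenvectors of the 1-Laplacian to (P)\<close>

lemma abs_le_1_of_Sgn: "a \<in> Sgn t \<Longrightarrow> \<bar>a\<bar> \<le> 1"
  by (auto simp: Sgn_def split: if_splits)

text \<open>The set where \<open>x\<close> is positive is the cut. Zero total divergence and
  \<open>\<mu> \<noteq> 0\<close> force \<open>s\<close> to be balanced; since all degrees are
  positive, \<open>s\<close> cannot be \<open>1\<close> everywhere, so this set is proper.\<close>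

lemma eigenvalue_P_of_flow:
  fixes E :: "'n::finite set set" and x s :: "'n \<Rightarrow> real"
  assumes G: "weighted_graph E w" and noiso: "\<forall>i. \<exists>j. {i, j} \<in> E" and "\<mu> \<noteq> 0"
    and z: "\<And>i j. {i, j} \<in> E \<Longrightarrow> z i j \<in> Sgn (x i - x j) \<and> z i j = - z j i"
    and s: "\<And>i. s i \<in> Sgn (x i)"
    and flow: "\<And>i. (\<Sum>j\<in>UNIV. wt E w i j * z i j) = \<mu> * (deg E w i * s i)"
    and pos: "0 < x k"
  shows "\<mu> \<in> nonconst_eigenvalues_P E w"
proof -
  have "(\<Sum>i\<in>UNIV. \<mu> * (deg E w i * s i)) = 0"
    unfolding flow[symmetric]
  proof (rule sum_skew_eq_0)
    show "wt E w i j * z i j = - (wt E w j i * z j i)" for i j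
      using z[of i j] by (auto simp: wt_def insert_commute)
  qed
  then have s0: "(\<Sum>i\<in>UNIV. deg E w i * s i) = 0"
    using \<open>\<mu> \<noteq> 0\<close> by (simp flip: sum_distrib_left)
  have degp: "0 < deg E w i" for i
    using noiso deg_pos[OF G] by blast
  have s1: "\<bar>s i\<bar> \<le> 1" for i
    using s by (rule abs_le_1_of_Sgn)
  have sA: "s i = 1" if "0 < x i" for i
    using s[of i] that by (simp add: Sgn_def)
  have "{i. 0 < x i} \<noteq> UNIV"
  proof
    assume "{i. 0 < x i} = UNIV"
    then have "s i = 1" for i by (intro sA) blast
    then have "(\<Sum>i\<in>UNIV. deg E w i) = 0" using s0 by simp
    moreover have "0 < (\<Sum>i\<in>UNIV. deg E w i)" by (rule sum_pos) (simp_all add: degp)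
    ultimately show False by simp
  qed
  moreover have "\<bar>z i j\<bar> \<le> 1" if "{i, j} \<in> E" for i j
    using z[OF that] by (blast intro: abs_le_1_of_Sgn)
  moreover have "z i j = 1" if "{i, j} \<in> E" "i \<in> {i. 0 < x i}" "j \<notin> {i. 0 < x i}" for i j
    using z[OF that(1)] that(2,3) by (simp add: Sgn_def)
  ultimately show ?thesis
    using pos z s0 s1 sA flow by (intro eigenvalue_P_of_cut[OF G, of "{i. 0 < x i}" z s]) auto
qed

text \<open>For eigenvalue \<open>0\<close> the flow equation says nothing about the signs, so a
  fresh balanced sign vector is taken, which is where \<open>A\<close> has to be the lighter
  side.\<close>

lemma zero_eigenvalue_P_of_cut:
  fixes E :: "'n::finite set set"
  assumes G: "weighted_graph E w" and A: "A \<noteq> {}" "A \<noteq> UNIV"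
    and le: "vol E w A \<le> vol E w (- A)"
    and z1: "\<And>i j. {i, j} \<in> E \<Longrightarrow> \<bar>z i j\<bar> \<le> 1"
    and zanti: "\<And>i j. {i, j} \<in> E \<Longrightarrow> z i j = - z j i"
    and zcut: "\<And>i j. {i, j} \<in> E \<Longrightarrow> i \<in> A \<Longrightarrow> j \<notin> A \<Longrightarrow> z i j = 1"
    and flow: "\<And>i. (\<Sum>j\<in>UNIV. wt E w i j * z i j) = 0"
  shows "0 \<in> nonconst_eigenvalues_P E w"
proof -
  obtain s where "\<And>i. i \<in> A \<Longrightarrow> s i = 1" "\<And>i. \<bar>s i\<bar> \<le> 1" "(\<Sum>i\<in>UNIV. deg E w i * s i) = 0"
    using balanced_sign_exists[OF G le] by blast
  then show ?thesis
  proof (intro eigenvalue_P_of_cut[OF G A z1 zanti zcut, where s = s])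
    show "(\<Sum>j\<in>UNIV. wt E w i j * z i j) = 0 * (deg E w i * s i)" for i
      using flow[of i] by simp
  qed
qed

text \<open>The cases differ in where a balanced sign vector comes from: an isolated vertex, the
  eigenvector itself when \<open>\<mu> \<noteq> 0\<close>, or a free choice when
  \<open>\<mu> = 0\<close>.\<close>

lemma nonconst_eigenvalue_Delta1_imp_P:
  fixes E :: "'n::finite set set"
  assumes G: "weighted_graph E w" and "\<mu> \<in> nonconst_eigenvalues_Delta1 E w"
  shows "\<mu> \<in> nonconst_eigenvalues_P E w"
proof -
  obtain x where "nonconstant x" "eigenpair_Delta1 E w \<mu> x"
    using assms(2) by (auto simp: nonconst_eigenvalues_Delta1_def)
  then obtain z s where "x \<noteq> 0"
    and z: "\<And>i j. {i, j} \<in> E \<Longrightarrow> z i j \<in> Sgn (x $ i - x $ j) \<and> z i j = - z j i"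
    and s: "\<And>i. s $ i \<in> Sgn (x $ i)"
    and flow: "\<And>i. (\<Sum>j\<in>UNIV. wt E w i j * z i j) = \<mu> * (deg E w i * s $ i)"
  proof -
    from \<open>eigenpair_Delta1 E w \<mu> x\<close> obtain z s where "x \<noteq> 0"
      "\<forall>i j. {i, j} \<in> E \<longrightarrow> z i j \<in> Sgn (x $ i - x $ j) \<and> z i j = - z j i"
      "\<forall>i. s $ i \<in> Sgn (x $ i)"
      "(\<chi> i. \<Sum>j | {i, j} \<in> E. w {i, j} * z i j) = (\<chi> i. \<mu> * (deg E w i * s $ i))"
      unfolding eigenpair_Delta1_def Delta1_def by blast
    then show ?thesis
      by (intro that[of z s]) (blast | simp only: vec_eq_iff sum_neighbours vec_lambda_beta)+
  qed
  obtain a b where ab: "x $ b < x $ a"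
    using \<open>nonconstant x\<close> unfolding nonconstant_def by (metis linorder_neqE_linordered_idom)
  have z1: "\<bar>z i j\<bar> \<le> 1" if "{i, j} \<in> E" for i j
    using z[OF that] by (blast intro: abs_le_1_of_Sgn)
  consider (isolated) v where "\<And>j. {v, j} \<notin> E"
    | (nonzero) "\<forall>i. \<exists>j. {i, j} \<in> E" "\<mu> \<noteq> 0" | (zero) "\<mu> = 0"
    by metis
  then show ?thesis
  proof cases
    case isolated
    then have "deg E w v = 0" by (simp add: deg_def)
    moreover have "{v} \<noteq> UNIV" using ab by (metis UNIV_I less_irrefl singletonD)
    moreover have "{v, j} \<notin> E \<and> {j, v} \<notin> E" for j
      using isolated by (simp add: insert_commute)
    \<comment> \<open>Signs supported on a vertex of degree zero are balanced, and the zero flow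
      satisfies the equation for every \<open>\<mu>\<close>.\<close>
    ultimately show ?thesis
      by (intro eigenvalue_P_of_cut[OF G, of "{v}" "\<lambda>_ _. 0" "\<lambda>i. if i = v then 1 else 0"])
        (auto simp: if_distrib cong: if_cong)
  next
    case nonzero
    obtain k where "x $ k \<noteq> 0" using \<open>x \<noteq> 0\<close> by (auto simp: vec_eq_iff)
    then consider "0 < x $ k" | "0 < - x $ k" by linarith
    then show ?thesis
    proof cases
      case 1
      then show ?thesis
        using eigenvalue_P_of_flow[OF G nonzero, where z = z and x = "($) x" and s = "($) s"]
          z s flow by blast
    next
      case 2
      \<comment> \<open>The eigenvalue relation is odd, so negating \<open>x\<close>,
        \<open>z\<close> and \<open>s\<close> together reduces to a positive coordinate.\<close>
      show ?thesis
      proof (rule eigenvalue_P_of_flow[OF G nonzero, where z = "\<lambda>i j. - z i j"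
            and x = "\<lambda>i. - x $ i" and s = "\<lambda>i. - s $ i"])
        show "- z i j \<in> Sgn (- x $ i - (- x $ j)) \<and> - z i j = - (- z j i)" if "{i, j} \<in> E" for i j
          using z[OF that] by (auto simp: Sgn_def split: if_splits)
        show "- s $ i \<in> Sgn (- x $ i)" for i
          using s[of i] by (auto simp: Sgn_def split: if_splits)
        show "(\<Sum>j\<in>UNIV. wt E w i j * (- z i j)) = \<mu> * (deg E w i * (- s $ i))" for i
          using flow[of i] by (simp add: sum_negf)
      qed (rule 2)
    qed
  next
    case zero
    \<comment> \<open>Any level set would do here, as the sign of \<open>x\<close> no longer
      matters; cutting at the value at \<open>b\<close> leaves \<open>a\<close> inside and
      \<open>b\<close> outside.\<close>
    define A where "A = {i. x $ b < x $ i}"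
    have A: "A \<noteq> {}" "A \<noteq> UNIV" using ab by (auto simp: A_def)
    have zA: "z i j = 1" if "{i, j} \<in> E" "i \<in> A" "j \<notin> A" for i j
      using z[OF that(1)] that(2,3) by (simp add: A_def Sgn_def)
    show ?thesis
    proof (cases "vol E w A \<le> vol E w (- A)")
      case True
      then show ?thesis
        unfolding zero using zero_eigenvalue_P_of_cut[OF G A True, of z] z z1 zA flow zero by simp
    next
      case False
      \<comment> \<open>If the complement is the lighter side, the roles are exchanged and the
        reversed flow leaves it with value \<open>1\<close>.\<close>
      show ?thesis
        unfolding zero
      proof (rule zero_eigenvalue_P_of_cut[OF G, of "- A" "\<lambda>i j. - z i j"])
        show "- A \<noteq> {}" "- A \<noteq> UNIV" using A by auto
        show "vol E w (- A) \<le> vol E w (- (- A))" using False by simp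
        fix i j assume ij: "{i, j} \<in> E"
        then have ji: "{j, i} \<in> E" by (simp add: insert_commute)
        show "\<bar>- z i j\<bar> \<le> 1" using z1[OF ij] by simp
        show "- z i j = - (- z j i)" using z[OF ij] by simp
        show "- z i j = 1" if "i \<in> - A" "j \<notin> - A"
          using z[OF ij] zA[OF ji] that by simp
      next
        show "(\<Sum>j\<in>UNIV. wt E w i j * (- z i j)) = 0" for i
          using flow[of i] zero by (simp add: sum_negf)
      qed
    qed
  qed
qed

section \<open>Coarea inequality and weighted medians\<close>

lemma total_variation_indicator:
  fixes E :: "'n::finite set set"
  shows "total_variation E w (\<lambda>i. if i \<in> S then 1 else 0) = 2 * cut E w S (- S)"
proof -
  let ?f = "\<lambda>i. if i \<in> S then 1 else 0 :: real"
  have split: "sum g UNIV = sum g S + sum g (- S)" for g :: "'n \<Rightarrow> real"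
    using sum.subset_diff[of S UNIV g] by (simp add: Compl_eq_Diff_UNIV)
  have "total_variation E w ?f = cut E w S (- S) + cut E w (- S) S"
    unfolding total_variation_def cut_eq_sum_wt split by simp
  then show ?thesis by (simp add: cut_commute)
qed

text \<open>
  A discrete coarea argument: peeling the minimal positive value of \<open>f\<close> off its support \<open>S\<close>
  lowers the total variation by exactly that value times twice the cut of \<open>S\<close>.
\<close>

lemma isoperimetric_imp_total_variation_ge:
  fixes E :: "'n::finite set set"
  assumes G: "weighted_graph E w"
    and H: "\<And>S. 2 * vol E w S \<le> vol E w UNIV \<Longrightarrow> h * vol E w S \<le> cut E w S (- S)"
    and "\<And>i. 0 \<le> f i" "2 * vol E w {i. 0 < f i} \<le> vol E w UNIV"
  shows "2 * (h * (\<Sum>i\<in>UNIV. deg E w i * f i)) \<le> total_variation E w f"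
  using assms(3,4)
proof (induction "card {i. 0 < f i}" arbitrary: f rule: less_induct)
  case less
  define S where "S = {i. 0 < f i}"
  show ?case
  proof (cases "S = {}")
    case True
    have "f i = 0" for i
    proof (rule antisym)
      show "f i \<le> 0" using True unfolding S_def by (simp add: not_less)
    qed (rule less.prems)
    then show ?thesis by (simp add: total_variation_def)
  next
    case False
    define m where "m = Min (f ` S)"
    have m_le: "m \<le> f i" if "i \<in> S" for i using that by (simp add: m_def)
    obtain k where k: "k \<in> S" "f k = m"
      using Min_in[of "f ` S"] False unfolding m_def by fastforce
    have m: "0 < m" using k by (auto simp: S_def)
    define \<phi> where "\<phi> i = (if i \<in> S then 1 else 0 :: real)" for i
    define g where "g i = f i - m * \<phi> i" for i
    have f0: "f i = 0" if "i \<notin> S" for i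
      using that less.prems(1)[of i] by (auto simp: S_def)
    have g_nonneg: "0 \<le> g i" for i
      using m_le f0 by (auto simp: g_def \<phi>_def)
    have sub: "{i. 0 < g i} \<subset> S"
    proof (rule psubsetI)
      show "{i. 0 < g i} \<subseteq> S"
      proof (rule subsetI, rule ccontr)
        fix i assume "i \<in> {i. 0 < g i}" "i \<notin> S"
        then show False using f0[of i] by (simp add: g_def \<phi>_def)
      qed
      show "{i. 0 < g i} \<noteq> S" using k by (auto simp: g_def \<phi>_def)
    qed
    have "vol E w {i. 0 < g i} \<le> vol E w S"
      unfolding vol_def using sub by (intro sum_mono2) (auto simp: deg_nonneg[OF G])
    then have vg: "2 * vol E w {i. 0 < g i} \<le> vol E w UNIV"
      using less.prems(2) by (simp add: S_def)
    have IH: "2 * (h * (\<Sum>i\<in>UNIV. deg E w i * g i)) \<le> total_variation E w g"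
      using sub by (intro less.hyps g_nonneg vg) (simp add: psubset_card_mono flip: S_def)
    \<comment> \<open>No cancellation occurs: if exactly one of the two vertices lies in
      \<open>S\<close>, then \<open>g\<close> vanishes at the other, so both differences point the
      same way.\<close>
    have abs_eq: "\<bar>f i - f j\<bar> = \<bar>g i - g j\<bar> + m * \<bar>\<phi> i - \<phi> j\<bar>" for i j
      using m m_le[of i] m_le[of j] f0[of i] f0[of j] by (auto simp: g_def \<phi>_def)
    have "total_variation E w f = total_variation E w g + m * total_variation E w \<phi>"
      unfolding total_variation_def abs_eq
      by (simp add: distrib_left sum.distrib sum_distrib_left mult.left_commute)
    moreover have "total_variation E w \<phi> = 2 * cut E w S (- S)"
      unfolding \<phi>_def by (rule total_variation_indicator)
    moreover have "(\<Sum>i\<in>UNIV. deg E w i * f i) = (\<Sum>i\<in>UNIV. deg E w i * g i) + m * vol E w S"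
    proof -
      have "vol E w S = (\<Sum>i\<in>UNIV. deg E w i * \<phi> i)"
        unfolding vol_def \<phi>_def by (simp add: if_distrib sum.If_cases cong: if_cong)
      then show ?thesis
        by (simp add: g_def sum.distrib[symmetric] sum_distrib_left algebra_simps)
    qed
    moreover have "m * (h * vol E w S) \<le> m * cut E w S (- S)"
      using less.prems(2) m by (intro mult_left_mono H) (simp_all add: S_def)
    ultimately show ?thesis
      using IH by (simp add: algebra_simps)
  qed
qed

text \<open>The median is the smallest value of \<open>f\<close> whose sublevel set carries at least
  half of the volume.\<close>

lemma weighted_median_exists:
  fixes E :: "'n::finite set set" and f :: "'n \<Rightarrow> real"
  assumes G: "weighted_graph E w"
  obtains t where "2 * vol E w {i. t < f i} \<le> vol E w UNIV" "2 * vol E w {i. f i < t} \<le> vol E w UNIV"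
proof -
  define T where "T = {t \<in> range f. vol E w UNIV \<le> 2 * vol E w {i. f i \<le> t}}"
  have fin: "finite T" by (simp add: T_def)
  have vnn: "0 \<le> vol E w S" for S
    unfolding vol_def by (rule sum_nonneg) (simp add: deg_nonneg G)
  have "{i. f i \<le> Max (range f)} = UNIV" by auto
  then have "Max (range f) \<in> T" using vnn[of UNIV] by (simp add: T_def)
  then have "T \<noteq> {}" by auto
  define t where "t = Min T"
  have "t \<in> T" using fin \<open>T \<noteq> {}\<close> by (simp add: t_def)
  have "- {i. f i \<le> t} = {i. t < f i}" by auto
  then have "2 * vol E w {i. t < f i} \<le> vol E w UNIV"
    using \<open>t \<in> T\<close> vol_UNIV_eq[of E w "{i. f i \<le> t}"] by (simp add: T_def)
  moreover have "2 * vol E w {i. f i < t} \<le> vol E w UNIV"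
  proof (cases "{i. f i < t} = {}")
    case True
    then show ?thesis using vnn[of UNIV] by (simp add: vol_def)
  next
    case False
    \<comment> \<open>The largest value below \<open>t\<close> has the strict sublevel set of
      \<open>t\<close> as its sublevel set, and by minimality of \<open>t\<close> that set carries
      less than half.\<close>
    define t' where "t' = Max (f ` {i. f i < t})"
    have "t' \<in> f ` {i. f i < t}" unfolding t'_def using False by (intro Max_in) auto
    moreover have "f i \<le> t'" if "f i < t" for i using that by (simp add: t'_def)
    ultimately have "t' < t" "t' \<in> range f" "{i. f i < t} = {i. f i \<le> t'}" by fastforce+
    moreover have "t' \<notin> T" using \<open>t' < t\<close> fin Min_le[of T t'] unfolding t_def by linarith
    ultimately show ?thesis by (simp add: T_def)
  qed
  ultimately show ?thesis by (rule that)
qed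

text \<open>Around a median both the positive and the negative part of \<open>f - t\<close> have
  supports of at most half the volume, and total variation as well as deviation are sums over the
  two parts.\<close>

lemma total_variation_ge_weighted_deviation:
  fixes E :: "'n::finite set set"
  assumes G: "weighted_graph E w"
    and H: "\<And>S. 2 * vol E w S \<le> vol E w UNIV \<Longrightarrow> h * vol E w S \<le> cut E w S (- S)"
  obtains t where "2 * (h * (\<Sum>i\<in>UNIV. deg E w i * \<bar>f i - t\<bar>)) \<le> total_variation E w f"
proof -
  obtain t where t: "2 * vol E w {i. t < f i} \<le> vol E w UNIV" "2 * vol E w {i. f i < t} \<le> vol E w UNIV"
    using weighted_median_exists[OF G] .
  define g where "g i = max 0 (f i - t)" for i
  define g' where "g' i = max 0 (t - f i)" for i
  have sets: "{i. 0 < g i} = {i. t < f i}" "{i. 0 < g' i} = {i. f i < t}"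
    by (auto simp: g_def g'_def)
  have "2 * (h * (\<Sum>i\<in>UNIV. deg E w i * g i)) \<le> total_variation E w g"
    by (rule isoperimetric_imp_total_variation_ge[OF G H]) (use t sets in \<open>simp_all add: g_def\<close>)
  moreover have "2 * (h * (\<Sum>i\<in>UNIV. deg E w i * g' i)) \<le> total_variation E w g'"
    by (rule isoperimetric_imp_total_variation_ge[OF G H]) (use t sets in \<open>simp_all add: g'_def\<close>)
  moreover have "\<bar>f i - t\<bar> = g i + g' i" for i by (auto simp: g_def g'_def)
  moreover have "\<bar>f i - f j\<bar> = \<bar>g i - g j\<bar> + \<bar>g' i - g' j\<bar>" for i j
    by (auto simp: g_def g'_def)
  ultimately show ?thesis
    by (intro that[of t]) (simp add: total_variation_def distrib_left sum.distrib)
qed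

section \<open>Lower bound for the eigenvalues of (P)\<close>

text \<open>Euler's identity turns the inclusion into an equation between function values.
  Nonconstancy and positive degrees make \<open>Nfun E w x\<close> positive, so it can be cancelled
  at the end.\<close>

lemma eigenvalue_P_ge:
  fixes E :: "'n::finite set set"
  assumes G: "weighted_graph E w" and noiso: "\<forall>i. \<exists>j. {i, j} \<in> E" and h: "0 \<le> h"
    and H: "\<And>S. 2 * vol E w S \<le> vol E w UNIV \<Longrightarrow> h * vol E w S \<le> cut E w S (- S)"
    and "\<mu> \<in> nonconst_eigenvalues_P E w"
  shows "h \<le> \<mu>"
proof -
  obtain x p q r where nc: "nonconstant x" and p: "p \<in> subdifferential infnorm x"
    and q: "q \<in> subdifferential (Iplus E w) x" and r: "r \<in> subdifferential (Nfun E w) x"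
    and eq: "vol E w UNIV *\<^sub>R p - q - \<mu> *\<^sub>R r = 0"
    using assms(5) unfolding nonconst_eigenvalues_P_def eigenpair_P_def Delta1_plus_def by force
  define D where "D t = (\<Sum>i\<in>UNIV. deg E w i * \<bar>x $ i - t\<bar>)" for t
  have degp: "0 < deg E w i" for i
    using noiso deg_pos[OF G] by blast
  have N_le: "Nfun E w y \<le> (\<Sum>i\<in>UNIV. deg E w i * \<bar>y $ i - t\<bar>)" for y t
    by (rule Nfun_le[OF G])
  have N0: "Nfun E w 0 = 0"
  proof (rule antisym)
    show "Nfun E w 0 \<le> 0" using N_le[of 0 0] by simp
    show "0 \<le> Nfun E w 0"
      unfolding Nfun_def by (rule cINF_greatest) (simp_all add: sum_nonneg deg_nonneg[OF G])
  qed
  have N2: "Nfun E w (2 *\<^sub>R x) = 2 * Nfun E w x"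
  proof (rule antisym)
    \<comment> \<open>Doubling \<open>t\<close> along with \<open>x\<close> matches the two families
      whose infima are compared.\<close>
    have scale: "(\<Sum>i\<in>UNIV. deg E w i * \<bar>(2 *\<^sub>R x) $ i - 2 * t\<bar>) = 2 * D t" for t
      unfolding D_def sum_distrib_left
    proof (rule sum.cong)
      fix i
      have "\<bar>2 * x $ i - 2 * t\<bar> = 2 * \<bar>x $ i - t\<bar>" by (simp add: abs_if)
      then show "deg E w i * \<bar>(2 *\<^sub>R x) $ i - 2 * t\<bar> = 2 * (deg E w i * \<bar>x $ i - t\<bar>)"
        by simp
    qed simp
    have "Nfun E w (2 *\<^sub>R x) / 2 \<le> Nfun E w x"
      unfolding Nfun_def[of E w x]
    proof (rule cINF_greatest)
      fix t
      show "Nfun E w (2 *\<^sub>R x) / 2 \<le> (\<Sum>i\<in>UNIV. deg E w i * \<bar>x $ i - t\<bar>)"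
        using N_le[of "2 *\<^sub>R x" "2 * t"] unfolding scale by (simp add: D_def)
    qed simp
    then show "Nfun E w (2 *\<^sub>R x) \<le> 2 * Nfun E w x" by simp
    show "2 * Nfun E w x \<le> Nfun E w (2 *\<^sub>R x)"
      unfolding Nfun_def[of E w "2 *\<^sub>R x"]
    proof (rule cINF_greatest)
      fix t
      show "2 * Nfun E w x \<le> (\<Sum>i\<in>UNIV. deg E w i * \<bar>(2 *\<^sub>R x) $ i - t\<bar>)"
        using N_le[of x "t / 2"] scale[of "t / 2"] by (simp add: D_def)
    qed simp
  qed
  have Npos: "0 < Nfun E w x"
  proof -
    obtain a b where ab: "x $ a \<noteq> x $ b" using nc by (auto simp: nonconstant_def)
    \<comment> \<open>Two distinct coordinates cannot both be close to \<open>t\<close>; the smaller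
      of the two degrees gives a bound independent of \<open>t\<close>.\<close>
    define \<delta> where "\<delta> = min (deg E w a) (deg E w b)"
    have \<delta>: "0 < \<delta>" using degp by (simp add: \<delta>_def)
    have "\<delta> * \<bar>x $ a - x $ b\<bar> \<le> Nfun E w x"
      unfolding Nfun_def
    proof (rule cINF_greatest)
      fix t
      have "\<delta> * \<bar>x $ a - x $ b\<bar> \<le> \<delta> * (\<bar>x $ a - t\<bar> + \<bar>x $ b - t\<bar>)"
        using \<delta> by (intro mult_left_mono) auto
      also have "\<dots> \<le> deg E w a * \<bar>x $ a - t\<bar> + deg E w b * \<bar>x $ b - t\<bar>"
        unfolding distrib_left by (intro add_mono mult_right_mono) (simp_all add: \<delta>_def)
      also have "\<dots> = (\<Sum>i\<in>{a, b}. deg E w i * \<bar>x $ i - t\<bar>)"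
        using ab by (subst sum.insert) auto
      also have "\<dots> \<le> (\<Sum>i\<in>UNIV. deg E w i * \<bar>x $ i - t\<bar>)"
        by (rule sum_mono2) (simp_all add: deg_nonneg[OF G])
      finally show "\<delta> * \<bar>x $ a - x $ b\<bar> \<le> (\<Sum>i\<in>UNIV. deg E w i * \<bar>x $ i - t\<bar>)" .
    qed simp
    moreover have "0 < \<delta> * \<bar>x $ a - x $ b\<bar>" using \<delta> ab by simp
    ultimately show ?thesis by linarith
  qed
  have "p \<bullet> x = infnorm x"
    by (rule subdifferential_homogeneous[OF p]) (simp_all add: infnorm_0 infnorm_mul)
  moreover have "q \<bullet> x = Iplus E w x"
  proof (rule subdifferential_homogeneous[OF q])
    show "Iplus E w (2 *\<^sub>R x) = 2 * Iplus E w x"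
      unfolding Iplus_def sum_distrib_left[of 2]
      by (simp add: abs_mult mult.left_commute flip: sum_distrib_left)
  qed (simp add: Iplus_def)
  moreover have "r \<bullet> x = Nfun E w x"
    by (rule subdifferential_homogeneous[OF r N0 N2])
  moreover have "vol E w UNIV * (p \<bullet> x) - q \<bullet> x - \<mu> * (r \<bullet> x) = 0"
    using arg_cong[OF eq, of "\<lambda>v. v \<bullet> x"] by (simp add: inner_diff_left)
  ultimately have \<mu>: "\<mu> * Nfun E w x = vol E w UNIV * infnorm x - Iplus E w x" by simp
  obtain t where t: "2 * (h * D t) \<le> total_variation E w (($) x)"
    using total_variation_ge_weighted_deviation[OF G H, of "($) x"] unfolding D_def by blast
  have "total_variation E w (($) x) + 2 * Iplus E w x \<le> 2 * (vol E w UNIV * infnorm x)"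
  proof -
    have "\<bar>x $ i - x $ j\<bar> + \<bar>x $ i + x $ j\<bar> \<le> 2 * infnorm x" for i j
      using component_le_infnorm_cart[of x i] component_le_infnorm_cart[of x j] by linarith
    then have "wt E w i j * (\<bar>x $ i - x $ j\<bar> + \<bar>x $ i + x $ j\<bar>) \<le> wt E w i j * (2 * infnorm x)" for i j
      by (intro mult_left_mono wt_nonneg[OF G])
    then have "(\<Sum>i\<in>UNIV. \<Sum>j\<in>UNIV. wt E w i j * (\<bar>x $ i - x $ j\<bar> + \<bar>x $ i + x $ j\<bar>))
        \<le> (\<Sum>i\<in>UNIV. \<Sum>j\<in>UNIV. wt E w i j * (2 * infnorm x))"
      by (intro sum_mono)
    also have "\<dots> = 2 * (vol E w UNIV * infnorm x)"
      by (simp add: vol_def deg_eq_sum_wt sum_distrib_left sum_distrib_right mult_ac)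
    finally show ?thesis
      unfolding Iplus_eq_sum_wt[OF G] total_variation_def by (simp add: distrib_left sum.distrib)
  qed
  then have "h * D t \<le> \<mu> * Nfun E w x" using t \<mu> by linarith
  moreover have "h * Nfun E w x \<le> h * D t"
    unfolding D_def by (intro mult_left_mono N_le h)
  ultimately have "h * Nfun E w x \<le> \<mu> * Nfun E w x" by linarith
  then show ?thesis using Npos by simp
qed

section \<open>The Cheeger constant as an eigenvalue of the 1-Laplacian\<close>

text \<open>
  The flows admissible for the indicator of \<open>A\<close> form a compact convex set. A hyperplane
  separating it from \<open>\<mu> r\<close> is a direction in which the total variation of the indicator would
  grow more slowly than the subgradient inequality allows.
\<close>

lemma subgradient_at_indicator_imp_eigenvalue_Delta1:
  fixes E :: "'n::finite set set"
  assumes G: "weighted_graph E w" and A: "A \<noteq> {}" "A \<noteq> UNIV"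
    and sA: "\<And>i. i \<in> A \<Longrightarrow> s i = 1" and s1: "\<And>i. \<bar>s i\<bar> \<le> 1"
    and le: "\<And>f. 2 * (\<mu> * (\<Sum>i\<in>UNIV. deg E w i * s i * f i)) \<le> total_variation E w f"
    and eq: "cut E w A (- A) = \<mu> * vol E w A"
  shows "\<mu> \<in> nonconst_eigenvalues_Delta1 E w"
proof -
  define x where "x = (\<chi> i. if i \<in> A then 1 else (0::real))"
  define v where "v = (\<chi> i. \<mu> * (deg E w i * s i))"
  \<comment> \<open>The constraints are imposed on all pairs, not only on edges, so that
    \<open>Z\<close> is bounded; entries at non-edges have weight zero in
    \<open>flow\<close>.\<close>
  define Z where "Z = {z :: real^'n^'n. \<forall>i j. z $ i $ j \<in> Sgn (x $ i - x $ j) \<and> z $ i $ j = - z $ j $ i}"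
  define flow where "flow z = (\<chi> i. \<Sum>j\<in>UNIV. wt E w i j * z $ i $ j)" for z :: "real^'n^'n"
  have Sgn_interval: "Sgn t = {if t > 0 then 1 else -1..if t < 0 then -1 else 1}" for t
    by (auto simp: Sgn_def)
  have x_diff: "x $ i - x $ j \<in> {-1, 0, 1}" for i j
    by (simp add: x_def)
  have Z_eq: "Z = (\<Inter>i. \<Inter>j. {z. z $ i $ j \<in> Sgn (x $ i - x $ j)} \<inter> {z. z $ i $ j = - z $ j $ i})"
    unfolding Z_def by blast
  have lin: "linear flow"
    by (rule linearI) (simp_all add: flow_def vec_eq_iff distrib_left sum.distrib sum_distrib_left mult.left_commute)
  have "convex Z"
    unfolding Z_def convex_alt
  proof (intro ballI allI impI CollectI, elim CollectE)
    fix z z' :: "real^'n^'n" and u :: real and i j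
    assume *: "\<forall>i j. z $ i $ j \<in> Sgn (x $ i - x $ j) \<and> z $ i $ j = - z $ j $ i"
      "\<forall>i j. z' $ i $ j \<in> Sgn (x $ i - x $ j) \<and> z' $ i $ j = - z' $ j $ i" "0 \<le> u \<and> u \<le> 1"
    have "convex (Sgn (x $ i - x $ j))" by (simp add: Sgn_interval)
    then have "(1 - u) *\<^sub>R z $ i $ j + u *\<^sub>R z' $ i $ j \<in> Sgn (x $ i - x $ j)"
      using * unfolding convex_alt by blast
    moreover have "z $ i $ j = - z $ j $ i" "z' $ i $ j = - z' $ j $ i" using * by blast+
    ultimately show "((1 - u) *\<^sub>R z + u *\<^sub>R z') $ i $ j \<in> Sgn (x $ i - x $ j) \<and>
        ((1 - u) *\<^sub>R z + u *\<^sub>R z') $ i $ j = - ((1 - u) *\<^sub>R z + u *\<^sub>R z') $ j $ i"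
      by (simp add: algebra_simps)
  qed
  have "closed Z"
    unfolding Z_eq Sgn_interval atLeastAtMost_iff Collect_conj_eq
    by (intro closed_INT ballI closed_Int closed_Collect_le closed_Collect_eq continuous_intros)
  moreover have "bounded Z"
  proof (rule boundedI)
    fix z assume "z \<in> Z"
    then have "z $ i $ j \<in> Sgn (x $ i - x $ j)" for i j unfolding Z_def by blast
    then have "\<bar>z $ i $ j\<bar> \<le> 1" for i j
      by (rule abs_le_1_of_Sgn)
    then have "norm (z $ i) \<le> real CARD('n)" for i
      using norm_le_l1_cart[of "z $ i"] sum_bounded_above[of UNIV "\<lambda>j. \<bar>z $ i $ j\<bar>" 1] by simp
    then have "(\<Sum>i\<in>UNIV. norm (z $ i)) \<le> real CARD('n) * real CARD('n)"
      using sum_bounded_above[of UNIV "\<lambda>i. norm (z $ i)" "real CARD('n)"] by simp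
    moreover have "norm z \<le> (\<Sum>i\<in>UNIV. norm (z $ i))"
      unfolding norm_vec_def by (rule L2_set_le_sum) simp
    ultimately show "norm z \<le> real CARD('n) * real CARD('n)" by linarith
  qed
  ultimately have "compact (flow ` Z)"
    using lin by (intro compact_continuous_image linear_continuous_on)
      (simp_all add: compact_eq_bounded_closed linear_conv_bounded_linear)
  have inner_flow: "2 * (flow z \<bullet> y) = (\<Sum>i\<in>UNIV. \<Sum>j\<in>UNIV. wt E w i j * (z $ i $ j * (y $ i - y $ j)))"
    if "z \<in> Z" for z y
  proof -
    have 1: "flow z \<bullet> y = (\<Sum>i\<in>UNIV. \<Sum>j\<in>UNIV. wt E w i j * (z $ i $ j * y $ i))"
      by (simp add: flow_def inner_vec_def sum_distrib_right mult.assoc)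
    have "wt E w j i * (z $ j $ i * y $ j) = - (wt E w i j * (z $ i $ j * y $ j))" for i j
    proof -
      have "z $ j $ i = - z $ i $ j" using that unfolding Z_def by blast
      then show ?thesis using wt_commute[of E w j i] by simp
    qed
    then have 2: "flow z \<bullet> y = (\<Sum>i\<in>UNIV. \<Sum>j\<in>UNIV. - (wt E w i j * (z $ i $ j * y $ j)))"
      unfolding 1 by (subst sum.swap) simp
    show ?thesis
      unfolding mult_2 by (subst 1, subst 2) (simp add: sum.distrib[symmetric] right_diff_distrib)
  qed
  have v_inner: "v \<bullet> y = \<mu> * (\<Sum>i\<in>UNIV. deg E w i * s i * y $ i)" for y
    by (simp add: v_def inner_vec_def sum_distrib_left mult.assoc)
  have "v \<in> flow ` Z"
  proof (rule ccontr)
    assume "v \<notin> flow ` Z"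
    moreover have "convex (flow ` Z)" using lin \<open>convex Z\<close> by (rule convex_linear_image)
    moreover have "closed (flow ` Z)" using \<open>compact (flow ` Z)\<close> by (rule compact_imp_closed)
    ultimately obtain a b where ab: "a \<bullet> v < b" "\<And>k. k \<in> flow ` Z \<Longrightarrow> b < a \<bullet> k"
      using separating_hyperplane_closed_point by metis
    define \<epsilon> where "\<epsilon> = 1 / (2 * norm a + 1)"
    have \<epsilon>: "0 < \<epsilon>" by (simp add: \<epsilon>_def add_nonneg_pos)
    \<comment> \<open>The step against \<open>a\<close> is so short that no difference changes by
      \<open>1\<close> or more. Hence the signs of \<open>y\<close> are still admissible for
      \<open>x\<close>, and one flow \<open>z\<close> represents the total variation at both
      points.\<close>
    define y where "y = x - \<epsilon> *\<^sub>R a"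
    define z where "z = (\<chi> i j. sgn (y $ i - y $ j))"
    have small: "\<epsilon> * \<bar>a $ i - a $ j\<bar> < 1" for i j
    proof -
      have "\<bar>a $ i - a $ j\<bar> < 2 * norm a + 1"
        using component_le_norm_cart[of a i] component_le_norm_cart[of a j] by linarith
      then show ?thesis by (simp add: \<epsilon>_def divide_less_eq add_nonneg_pos)
    qed
    have zZ: "z \<in> Z"
      unfolding Z_def
    proof (intro CollectI allI conjI)
      fix i j
      have "\<bar>\<epsilon> * (a $ i - a $ j)\<bar> < 1"
        using small[of i j] \<epsilon> by (simp add: abs_mult)
      moreover have "y $ i - y $ j = (x $ i - x $ j) - \<epsilon> * (a $ i - a $ j)"
        by (simp add: y_def right_diff_distrib)
      ultimately show "z $ i $ j \<in> Sgn (x $ i - x $ j)"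
        using x_diff[of i j] by (auto simp: z_def Sgn_def sgn_if)
      show "z $ i $ j = - z $ j $ i" by (simp add: z_def sgn_if)
    qed
    have "2 * (flow z \<bullet> y) = total_variation E w (($) y)"
      unfolding inner_flow[OF zZ] total_variation_def by (simp add: z_def abs_sgn mult.commute)
    then have "v \<bullet> y \<le> flow z \<bullet> y"
      using le[of "($) y"] by (simp add: v_inner)
    \<comment> \<open>Equality at \<open>x\<close> and the inequality at \<open>y\<close> leave only
      the increment along \<open>a\<close>, whose direction contradicts the separation.\<close>
    moreover have "v \<bullet> x = flow z \<bullet> x"
    proof -
      have "z $ i $ j * (x $ i - x $ j) = \<bar>x $ i - x $ j\<bar>" for i j
      proof -
        have "z $ i $ j \<in> Sgn (x $ i - x $ j)" using zZ unfolding Z_def by blast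
        then show ?thesis by (auto simp: Sgn_def split: if_splits)
      qed
      then have "2 * (flow z \<bullet> x) = total_variation E w (\<lambda>i. if i \<in> A then 1 else 0)"
        unfolding inner_flow[OF zZ] by (simp add: total_variation_def x_def)
      moreover have "v \<bullet> x = \<mu> * vol E w A"
      proof -
        have "(\<Sum>i\<in>UNIV. deg E w i * s i * x $ i) = (\<Sum>i\<in>UNIV. if i \<in> A then deg E w i else 0)"
          by (rule sum.cong) (auto simp: x_def sA)
        then show ?thesis
          unfolding v_inner by (simp add: vol_def sum.If_cases)
      qed
      ultimately show ?thesis by (simp add: total_variation_indicator eq)
    qed
    ultimately have "\<epsilon> * (a \<bullet> flow z) \<le> \<epsilon> * (a \<bullet> v)"
      by (simp add: y_def inner_diff_right inner_commute)
    then have "a \<bullet> flow z \<le> a \<bullet> v" using \<epsilon> by simp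
    moreover have "b < a \<bullet> flow z" using ab(2) zZ by blast
    ultimately show False using ab(1) by linarith
  qed
  then obtain z where z: "z \<in> Z" "v = flow z" by blast
  have "v \<in> Delta1 E w x"
    unfolding Delta1_def sum_neighbours
  proof (intro CollectI exI[of _ "\<lambda>i j. z $ i $ j"] conjI)
    show "v = (\<chi> i. \<Sum>j\<in>UNIV. wt E w i j * z $ i $ j)" using z(2) by (simp only: flow_def)
    show "\<forall>i j. {i, j} \<in> E \<longrightarrow> z $ i $ j \<in> Sgn (x $ i - x $ j) \<and> z $ i $ j = - z $ j $ i"
      using z(1) unfolding Z_def by blast
  qed
  moreover have "(\<chi> i. s i) $ i \<in> Sgn (x $ i)" for i
    using s1[of i] sA[of i] by (auto simp: x_def Sgn_def abs_le_iff)
  then have "v \<in> {(\<chi> i. \<mu> * (deg E w i * s $ i)) | s. \<forall>i. s $ i \<in> Sgn (x $ i)}"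
    by (intro CollectI exI[of _ "\<chi> i. s i"]) (simp add: v_def)
  moreover obtain a b where "a \<in> A" "b \<notin> A" using A by auto
  then have "x $ a = 1" "x $ b = 0" by (simp_all add: x_def)
  then have "nonconstant x" "x \<noteq> 0"
    unfolding nonconstant_def by (metis zero_neq_one, metis zero_index zero_neq_one)
  ultimately show ?thesis
    unfolding nonconst_eigenvalues_Delta1_def eigenpair_Delta1_def by blast
qed

text \<open>The isoperimetric inequality is the minimality of the ratio, read on the side with at
  most half the volume; a minimising cut gives equality and hence the eigenvector.\<close>

lemma cheeger_eigenvalue_Delta1:
  fixes E :: "'n::finite set set"
  assumes G: "weighted_graph E w" and noiso: "\<forall>i. \<exists>j. {i, j} \<in> E"
  shows "cheeger E w \<in> nonconst_eigenvalues_Delta1 E w"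
    and "0 \<le> cheeger E w"
    and "\<And>S. 2 * vol E w S \<le> vol E w UNIV \<Longrightarrow> cheeger E w * vol E w S \<le> cut E w S (- S)"
proof -
  define ratio where "ratio S = cut E w S (- S) / min (vol E w S) (vol E w (- S))" for S
  define Q where "Q = ratio ` {S. S \<noteq> {} \<and> S \<noteq> UNIV}"
  have cheeger: "cheeger E w = Min Q"
    unfolding cheeger_def Q_def ratio_def by (rule arg_cong[of _ _ Min]) blast
  have vol_pos: "0 < vol E w S" if "S \<noteq> {}" for S
    unfolding vol_def using that noiso deg_pos[OF G] by (intro sum_pos) auto
  obtain i j :: 'n where "{i, j} \<in> E" using noiso by blast
  then have "i \<noteq> j" using G by (auto simp: weighted_graph_def)
  then have "{i} \<noteq> UNIV" by (metis UNIV_I singletonD)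
  then have "Q \<noteq> {}" unfolding Q_def by blast
  then have "Min Q \<in> Q" by (intro Min_in) (simp add: Q_def)
  then obtain S where S: "S \<noteq> {}" "S \<noteq> UNIV" "cheeger E w = ratio S"
    unfolding cheeger by (auto simp: Q_def)
  have ratio_Compl: "ratio (- T) = ratio T" for T
    by (simp add: ratio_def cut_commute min.commute)
  \<comment> \<open>Since the ratio is invariant under complement, the minimiser may be taken to be
    the lighter side, as the balanced sign vector requires.\<close>
  obtain A where A: "A \<noteq> {}" "A \<noteq> UNIV" "cheeger E w = ratio A" "vol E w A \<le> vol E w (- A)"
  proof (cases "vol E w S \<le> vol E w (- S)")
    case False
    have "- S \<noteq> {}" "- S \<noteq> UNIV" using S by auto
    then show ?thesis using that[of "- S"] S False by (simp add: ratio_Compl)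
  qed (use S in \<open>rule that\<close>)
  have eq: "cut E w A (- A) = cheeger E w * vol E w A"
    using A vol_pos[of A] by (simp add: ratio_def)
  have "0 \<le> cut E w A (- A)"
    unfolding cut_eq_sum_wt by (intro sum_nonneg wt_nonneg[OF G])
  then show "0 \<le> cheeger E w" using vol_pos[OF A(1)] by (simp add: eq zero_le_mult_iff)
  show H: "cheeger E w * vol E w S \<le> cut E w S (- S)" if S: "2 * vol E w S \<le> vol E w UNIV" for S
  proof (cases "S = {}")
    case True
    then show ?thesis by (simp add: vol_def cut_def)
  next
    case False
    \<comment> \<open>The whole vertex set has positive volume and so exceeds half of it.\<close>
    have "S \<noteq> UNIV" using S vol_pos[of S] False by auto
    then have "cheeger E w \<le> ratio S"
      unfolding cheeger using False by (intro Min_le) (auto simp: Q_def)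
    moreover have "vol E w S \<le> vol E w (- S)" using S vol_UNIV_eq[of E w S] by simp
    ultimately show ?thesis using vol_pos[OF False] by (simp add: ratio_def pos_le_divide_eq)
  qed
  obtain s where s: "\<And>i. i \<in> A \<Longrightarrow> s i = 1" "\<And>i. \<bar>s i\<bar> \<le> 1" "(\<Sum>i\<in>UNIV. deg E w i * s i) = 0"
    using balanced_sign_exists[OF G A(4)] by blast
  show "cheeger E w \<in> nonconst_eigenvalues_Delta1 E w"
  proof (rule subgradient_at_indicator_imp_eigenvalue_Delta1[OF G A(1,2) s(1,2) _ eq])
    fix f
    \<comment> \<open>Balance of \<open>s\<close> allows \<open>f\<close> to be shifted by whichever
      \<open>t\<close> the coarea bound supplies.\<close>
    obtain t where t: "2 * (cheeger E w * (\<Sum>i\<in>UNIV. deg E w i * \<bar>f i - t\<bar>)) \<le> total_variation E w f"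
      using total_variation_ge_weighted_deviation[OF G H] .
    have "cheeger E w * (\<Sum>i\<in>UNIV. deg E w i * s i * f i)
        \<le> cheeger E w * (\<Sum>i\<in>UNIV. deg E w i * \<bar>f i - t\<bar>)"
      by (intro mult_left_mono balanced_inner_le[OF G s(2,3)] \<open>0 \<le> cheeger E w\<close>)
    then show "2 * (cheeger E w * (\<Sum>i\<in>UNIV. deg E w i * s i * f i)) \<le> total_variation E w f"
      using t by linarith
  qed
qed

theorem theorem2p5:
  fixes E :: "'n::finite set set" and w :: "'n set \<Rightarrow> real"
  assumes "weighted_graph E w"
  shows "(\<forall>\<mu>. \<mu> \<in> nonconst_eigenvalues_Delta1 E w \<longrightarrow> \<mu> \<in> nonconst_eigenvalues_P E w) \<and>
    ((\<forall>i. \<exists>j. {i, j} \<in> E) \<longrightarrow>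
       is_smallest (cheeger E w) (nonconst_eigenvalues_Delta1 E w) \<and>
       is_smallest (cheeger E w) (nonconst_eigenvalues_P E w))"
proof (intro conjI allI impI)
  show incl: "\<mu> \<in> nonconst_eigenvalues_P E w" if "\<mu> \<in> nonconst_eigenvalues_Delta1 E w" for \<mu>
    using nonconst_eigenvalue_Delta1_imp_P[OF assms that] .
  assume noiso: "\<forall>i. \<exists>j. {i, j} \<in> E"
  note cheeger = cheeger_eigenvalue_Delta1[OF assms noiso]
  \<comment> \<open>One bound serves both spectra: the inclusion carries the bound back to the
    1-Laplacian and carries attainment forward to (P).\<close>
  have "cheeger E w \<le> \<mu>" if "\<mu> \<in> nonconst_eigenvalues_P E w" for \<mu>
    by (rule eigenvalue_P_ge[OF assms noiso cheeger(2,3) that])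
  then show "is_smallest (cheeger E w) (nonconst_eigenvalues_Delta1 E w)"
    "is_smallest (cheeger E w) (nonconst_eigenvalues_P E w)"
    using cheeger(1) incl by (auto simp: is_smallest_def)
qed

end
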